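(* Let $T\in\mathbb C^m\otimes\mathbb C^m\otimes\mathbb C^m$ be concise, 111-sharp and of minimal border rank. Then the 111-algebra $\mathcal A_{111}^T$ is smoothable.
   Context: Let $A,B,C$ be complex vector spaces of dimension $m$, $T\in A\otimes B\otimes C$, and $T(A^* )\subseteq B\otimes C$, $T(B^* )\subseteq A\otimes C$, $T(C^* )\subseteq A\otimes B$ the images of the induced maps; $T$ is concise if these maps are injective. $T$ is 111-sharp if $(T(A^* )\otimes A)\cap(T(B^* )\otimes B)\cap(T(C^* )\otimes C)\subseteq A\otimes B\otimes C$ (factors in the correct positions) has dimension exactly $m$. The border rank of $T$ is the smallest $r$ such that $T$ is a limit of sums of $r$ rank one tensors; a concise tensor has minimal border rank if its border rank is $m$. The 111-algebra $\mathcal A_{111}^T\subseteq\mathrm{End}(A)\times\mathrm{End}(B)\times\mathrm{End}(C)$ is the set of triples $(X,Y,Z)$ such that $(X\otimes\mathrm{Id}_B\otimes\mathrm{Id}_C)(T)=(\mathrm{Id}_A\otimes Y\otimes\mathrm{Id}_C)(T)=(\mathrm{Id}_A\otimes\mathrm{Id}_B\otimes Z)(T)$; for concise $T$ it is a commutative unital algebra, and its dimension equals the dimension of $(T(A^* )\otimes A)\cap(T(B^* )\otimes B)\cap(T(C^* )\otimes C)$. An $m$-dimensional commutative unital $\mathbb C$-algebra is smoothable if it is a limit (in a flat family) of algebras isomorphic to $\prod_{i=1}^m\mathbb C$, i.e. if it corresponds to a point of the principal component (the closure of the locus of reduced points) of the Hilbert scheme of $m$ points. *)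

theory Defs
  imports
    "HOL-Analysis.Analysis"
    "HOL-Algebra.Module"
    "HOL-Algebra.QuotRing"
    "HOL-Algebra.Algebraic_Closure_Type"
begin

no_notation Formal_Power_Series.fps.fps_nth (infixl \<open>$\<close> 75)
no_notation Polynomials.var (\<open>X\<index>\<close>)

text \<open>
  Throughout, \<open>A = B = C = complex ^ 'n\<close>, with \<open>m = CARD('n)\<close>. Tensors are given by their
  coordinates in the standard bases: elements of \<open>A \<otimes> B \<otimes> C\<close> are vectors indexed by triples and
  elements of \<open>B \<otimes> C\<close>, \<open>A \<otimes> C\<close>, \<open>A \<otimes> B\<close> are vectors indexed by pairs. In this way they are
  complex vector spaces for \<open>*s\<close>, to which \<open>vec.span\<close> and \<open>vec.dim\<close> (over the complex numbers)
  apply, and they carry the Euclidean topology.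
\<close>

type_synonym 'n tensor3 = "complex ^ ('n \<times> 'n \<times> 'n)"
type_synonym 'n tensor2 = "complex ^ ('n \<times> 'n)"

definition pure3 :: "complex ^ 'n \<Rightarrow> complex ^ 'n \<Rightarrow> complex ^ 'n \<Rightarrow> ('n::finite) tensor3" where
  "pure3 a b c = vec_lambda (\<lambda>(i, j, k). a $ i * b $ j * c $ k)"

text \<open>The maps induced by \<open>T\<close>; functionals are given by their coordinates in the dual basis.\<close>

definition flatA :: "('n::finite) tensor3 \<Rightarrow> complex ^ 'n \<Rightarrow> 'n tensor2" where
  "flatA T \<alpha> = vec_lambda (\<lambda>(j, k). \<Sum>i\<in>UNIV. \<alpha> $ i * T $ (i, j, k))"

definition flatB :: "('n::finite) tensor3 \<Rightarrow> complex ^ 'n \<Rightarrow> 'n tensor2" where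
  "flatB T \<beta> = vec_lambda (\<lambda>(i, k). \<Sum>j\<in>UNIV. \<beta> $ j * T $ (i, j, k))"

definition flatC :: "('n::finite) tensor3 \<Rightarrow> complex ^ 'n \<Rightarrow> 'n tensor2" where
  "flatC T \<gamma> = vec_lambda (\<lambda>(i, j). \<Sum>k\<in>UNIV. \<gamma> $ k * T $ (i, j, k))"

definition concise :: "('n::finite) tensor3 \<Rightarrow> bool" where
  "concise T \<longleftrightarrow> inj (flatA T) \<and> inj (flatB T) \<and> inj (flatC T)"

text \<open>
  For a subspace \<open>S\<close> of \<open>B \<otimes> C\<close>, \<open>A \<otimes> C\<close>, \<open>A \<otimes> B\<close> respectively, the subspace of
  \<open>A \<otimes> B \<otimes> C\<close> spanned by the products of elements of \<open>S\<close> with vectors of the missing factor,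
  placed in its correct position.
\<close>

definition tensorA :: "('n::finite) tensor2 set \<Rightarrow> 'n tensor3 set" where
  "tensorA S = vec.span {vec_lambda (\<lambda>(i, j, k). a $ i * M $ (j, k)) |a M. M \<in> S}"

definition tensorB :: "('n::finite) tensor2 set \<Rightarrow> 'n tensor3 set" where
  "tensorB S = vec.span {vec_lambda (\<lambda>(i, j, k). b $ j * M $ (i, k)) |b M. M \<in> S}"

definition tensorC :: "('n::finite) tensor2 set \<Rightarrow> 'n tensor3 set" where
  "tensorC S = vec.span {vec_lambda (\<lambda>(i, j, k). c $ k * M $ (i, j)) |c M. M \<in> S}"

definition sharp111 :: "('n::finite) tensor3 \<Rightarrow> bool" where
  "sharp111 T \<longleftrightarrow>
     vec.dim (tensorA (range (flatA T)) \<inter> tensorB (range (flatB T)) \<inter> tensorC (range (flatC T)))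
       = CARD('n)"

definition rank_one :: "('n::finite) tensor3 \<Rightarrow> bool" where
  "rank_one S \<longleftrightarrow> (\<exists>a b c. a \<noteq> 0 \<and> b \<noteq> 0 \<and> c \<noteq> 0 \<and> S = pure3 a b c)"

definition border_rank :: "('n::finite) tensor3 \<Rightarrow> nat" where
  "border_rank T =
     (LEAST r. T \<in> closure {\<Sum>l<r. R l |R :: nat \<Rightarrow> 'n tensor3. \<forall>l<r. rank_one (R l)})"

text \<open>Meaningful for concise \<open>T\<close>, whose border rank is at least \<open>m\<close>.\<close>

definition minimal_border_rank :: "('n::finite) tensor3 \<Rightarrow> bool" where
  "minimal_border_rank T \<longleftrightarrow> border_rank T = CARD('n)"

text \<open>The actions of \<open>X \<otimes> Id \<otimes> Id\<close>, \<open>Id \<otimes> Y \<otimes> Id\<close>, \<open>Id \<otimes> Id \<otimes> Z\<close>.\<close>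

definition actA :: "complex ^ 'n ^ 'n \<Rightarrow> ('n::finite) tensor3 \<Rightarrow> 'n tensor3" where
  "actA X T = vec_lambda (\<lambda>(i, j, k). \<Sum>l\<in>UNIV. X $ i $ l * T $ (l, j, k))"

definition actB :: "complex ^ 'n ^ 'n \<Rightarrow> ('n::finite) tensor3 \<Rightarrow> 'n tensor3" where
  "actB Y T = vec_lambda (\<lambda>(i, j, k). \<Sum>l\<in>UNIV. Y $ j $ l * T $ (i, l, k))"

definition actC :: "complex ^ 'n ^ 'n \<Rightarrow> ('n::finite) tensor3 \<Rightarrow> 'n tensor3" where
  "actC Z T = vec_lambda (\<lambda>(i, j, k). \<Sum>l\<in>UNIV. Z $ k $ l * T $ (i, j, l))"

type_synonym 'n end3 = "(complex ^ 'n ^ 'n) \<times> (complex ^ 'n ^ 'n) \<times> (complex ^ 'n ^ 'n)"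

definition alg111 :: "('n::finite) tensor3 \<Rightarrow> (complex, 'n end3) module" where
  "alg111 T =
     \<lparr> carrier = {(X, Y, Z). actA X T = actB Y T \<and> actB Y T = actC Z T},
       monoid.mult = (\<lambda>(X, Y, Z) (X', Y', Z'). (X ** X', Y ** Y', Z ** Z')),
       one = (mat 1, mat 1, mat 1),
       zero = 0,
       add = (+),
       smult = (\<lambda>c (X, Y, Z). (\<chi> i. c *s X $ i, \<chi> i. c *s Y $ i, \<chi> i. c *s Z $ i)) \<rparr>"

text \<open>
  Commutative unital complex algebras are the instances of the locale \<open>algebra\<close> of
  HOL-Algebra (not the one of measure theory) over the field of complex numbers.
\<close>

abbreviation complex_algebra :: "(complex, 'v) module \<Rightarrow> bool" where
  "complex_algebra \<equiv> Module.algebra (ring_of_type_algebra :: complex ring)"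

definition algebra_iso :: "(complex, 'v) module \<Rightarrow> (complex, 'w) module \<Rightarrow> bool" where
  "algebra_iso M N \<longleftrightarrow> complex_algebra M \<and> complex_algebra N \<and>
     (\<exists>h \<in> ring_iso M N. \<forall>c. \<forall>x \<in> carrier M. h (c \<odot>\<^bsub>M\<^esub> x) = c \<odot>\<^bsub>N\<^esub> h x)"

text \<open>
  The product of \<open>d\<close> copies of the complex numbers, whose elements are encoded as the functions
  on the natural numbers that vanish outside \<open>{..<d}\<close>.
\<close>

definition prod_algebra :: "nat \<Rightarrow> (complex, nat \<Rightarrow> complex) module" where
  "prod_algebra d =
     \<lparr> carrier = {x. \<forall>i\<ge>d. x i = 0},
       monoid.mult = (\<lambda>x y i. x i * y i),
       one = (\<lambda>i. if i < d then 1 else 0),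
       zero = (\<lambda>i. 0),
       add = (\<lambda>x y i. x i + y i),
       smult = (\<lambda>c x i. c * x i) \<rparr>"

text \<open>
  The vector space underlying \<open>prod_algebra d\<close>, with another multiplication and unit.
\<close>

definition based_algebra ::
    "nat \<Rightarrow> ((nat \<Rightarrow> complex) \<Rightarrow> (nat \<Rightarrow> complex) \<Rightarrow> nat \<Rightarrow> complex) \<Rightarrow> (nat \<Rightarrow> complex) \<Rightarrow>
     (complex, nat \<Rightarrow> complex) module" where
  "based_algebra d \<mu> u = (prod_algebra d) \<lparr> monoid.mult := \<mu>, one := u \<rparr>"

text \<open>
  A finite flat family of algebras is locally free as a module over its base. After a local
  trivialization it is therefore a family of algebra structures on a fixed vector space, here that
  of \<open>d\<close>-tuples of complex numbers, whose multiplication and unit depend continuously on the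
  parameter. An algebra of dimension \<open>d\<close> is smoothable if, up to isomorphism, it is a limit of
  such structures all of which are isomorphic to the product of \<open>d\<close> copies of the complex numbers.
  (The set of these structures is constructible, so that its Euclidean closure is also its Zariski
  closure.)
\<close>

definition smoothable :: "(complex, 'v) module \<Rightarrow> bool" where
  "smoothable M \<longleftrightarrow>
     (\<exists>d \<mu> u \<mu>s us.
        algebra_iso M (based_algebra d \<mu> u) \<and>
        (\<forall>s::nat. algebra_iso (based_algebra d (\<mu>s s) (us s)) (prod_algebra d)) \<and>
        (\<forall>x \<in> carrier (prod_algebra d). \<forall>y \<in> carrier (prod_algebra d). \<forall>i.
           (\<lambda>s. \<mu>s s x y i) \<longlonglongrightarrow> \<mu> x y i) \<and>
        (\<forall>i. (\<lambda>s. us s i) \<longlonglongrightarrow> u i))"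

end

theory Submission
  imports Defs
begin

text \<open>
  A concise tensor of minimal border rank is a limit of tensors \<open>T\<^sub>s = \<Sum>\<^sub>l a\<^sub>l \<otimes> b\<^sub>l \<otimes> c\<^sub>l\<close> with
  \<open>m\<close> summands (\<open>minimal_border_rank_limit\<close>). Conciseness is an open condition, so that for large
  \<open>s\<close> the vectors \<open>a\<^sub>l\<close>, the vectors \<open>b\<^sub>l\<close> and the vectors \<open>c\<^sub>l\<close> are bases
  (\<open>eventually_invertible_factors\<close>). The triples of operators that are diagonal in these three
  bases, with the same eigenvalues, lie in the 111-algebra of \<open>T\<^sub>s\<close> and form a copy of the
  product of \<open>m\<close> copies of the complex numbers (\<open>conj_diag\<close>).

  These \<open>m\<close>-dimensional algebras converge to the whole 111-algebra of \<open>T\<close>. The latter is the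
  kernel of a linear map depending continuously on \<open>T\<close>, so that it contains every limit of
  elements of the algebras for \<open>T\<^sub>s\<close>; sharpness says that its dimension is also \<open>m\<close>, which leaves
  no room for anything else. Instead of taking limits in a Grassmannian, the proof fixes linear
  coordinates \<open>Q\<close> on triples of matrices that identify the 111-algebra of \<open>T\<close> with the space of
  vectors of length \<open>m\<close> (\<open>sharp111_coordinates\<close>). The linear map whose components are the
  defining equations of the 111-algebra and \<open>Q\<close> is injective at \<open>T\<close>, hence bounded below with a
  constant that is uniform for large \<open>s\<close> (\<open>eventually_bounded_below\<close>). This makes \<open>Q\<close> bijective on
  the algebra for \<open>T\<^sub>s\<close> too, and makes the inverses of these bijections converge
  (\<open>alg111_inverse_limit\<close>). Read through \<open>Q\<close>, all these algebras become multiplications on one and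
  the same space, with one and the same unit, and the multiplications converge because matrix
  multiplication is continuous.
\<close>

section \<open>The three actions on tensors\<close>

lemma actA_nth [simp]: "actA X T $ (i, j, k) = (\<Sum>l\<in>UNIV. X $ i $ l * T $ (l, j, k))"
  by (simp add: actA_def)

lemma actB_nth [simp]: "actB Y T $ (i, j, k) = (\<Sum>l\<in>UNIV. Y $ j $ l * T $ (i, l, k))"
  by (simp add: actB_def)

lemma actC_nth [simp]: "actC Z T $ (i, j, k) = (\<Sum>l\<in>UNIV. Z $ k $ l * T $ (i, j, l))"
  by (simp add: actC_def)

lemma flatA_nth [simp]: "flatA T \<alpha> $ (j, k) = (\<Sum>i\<in>UNIV. \<alpha> $ i * T $ (i, j, k))"
  by (simp add: flatA_def)

lemma flatB_nth [simp]: "flatB T \<beta> $ (i, k) = (\<Sum>j\<in>UNIV. \<beta> $ j * T $ (i, j, k))"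
  by (simp add: flatB_def)

lemma flatC_nth [simp]: "flatC T \<gamma> $ (i, j) = (\<Sum>k\<in>UNIV. \<gamma> $ k * T $ (i, j, k))"
  by (simp add: flatC_def)

lemma scaleR_eq_smult: "r *\<^sub>R (v :: complex ^ 'k) = of_real r *s v"
  by (simp add: vec_eq_iff) (simp add: scaleR_conv_of_real)

lemma act_comp:
  "actA (X ** Y) T = actA X (actA Y T)"
  "actB (X ** Y) T = actB X (actB Y T)"
  "actC (X ** Y) T = actC X (actC Y T)"
proof -
  have *: "(\<Sum>l\<in>UNIV. (\<Sum>m\<in>UNIV. f m * g m l) * h l) = (\<Sum>m\<in>UNIV. f m * (\<Sum>l\<in>UNIV. g m l * h l))"
    for f h :: "'a \<Rightarrow> complex" and g
    by (subst sum_distrib_left, subst sum_distrib_right, subst sum.swap) (simp add: mult.assoc)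
  show
    "actA (X ** Y) T = actA X (actA Y T)"
    "actB (X ** Y) T = actB X (actB Y T)"
    "actC (X ** Y) T = actC X (actC Y T)"
    by (simp_all add: vec_eq_iff matrix_matrix_mult_def *)
qed

lemma act_commute:
  "actA X (actB Y T) = actB Y (actA X T)"
  "actA X (actC Z T) = actC Z (actA X T)"
  "actB Y (actC Z T) = actC Z (actB Y T)"
proof -
  have *: "(\<Sum>l\<in>UNIV. f l * (\<Sum>m\<in>UNIV. g m * h l m)) = (\<Sum>m\<in>UNIV. g m * (\<Sum>l\<in>UNIV. f l * h l m))"
    for f g :: "'a \<Rightarrow> complex" and h
  proof -
    have "(\<Sum>l\<in>UNIV. f l * (\<Sum>m\<in>UNIV. g m * h l m)) = (\<Sum>l\<in>UNIV. \<Sum>m\<in>UNIV. g m * (f l * h l m))"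
      by (simp add: sum_distrib_left mult.left_commute)
    also have "\<dots> = (\<Sum>m\<in>UNIV. \<Sum>l\<in>UNIV. g m * (f l * h l m))" by (rule sum.swap)
    finally show ?thesis by (simp add: sum_distrib_left)
  qed
  show
    "actA X (actB Y T) = actB Y (actA X T)"
    "actA X (actC Z T) = actC Z (actA X T)"
    "actB Y (actC Z T) = actC Z (actB Y T)"
    by (simp_all add: vec_eq_iff) (intro allI, rule * )+
qed

lemma act_one: "actA (mat 1) T = T" "actB (mat 1) T = T" "actC (mat 1) T = T"
  by (simp_all add: vec_eq_iff mat_def mult_delta_left)

lemma act_add:
  "actA (X + X') T = actA X T + actA X' T"
  "actB (X + X') T = actB X T + actB X' T"
  "actC (X + X') T = actC X T + actC X' T"
  by (simp_all add: vec_eq_iff algebra_simps sum.distrib)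

lemma act_smult:
  "actA (\<chi> i. c *s X $ i) T = c *s actA X T"
  "actB (\<chi> i. c *s X $ i) T = c *s actB X T"
  "actC (\<chi> i. c *s X $ i) T = c *s actC X T"
  by (simp_all add: vec_eq_iff sum_distrib_left mult.assoc)

lemma linear_act:
  "linear (\<lambda>X. actA X T)" "linear (\<lambda>X. actB X T)" "linear (\<lambda>X. actC X T)"
  by (auto intro!: linearI simp: vec_eq_iff algebra_simps sum.distrib scaleR_sum_right)

lemma linear_flat: "linear (flatA T)" "linear (flatB T)" "linear (flatC T)"
  by (auto intro!: linearI simp: vec_eq_iff algebra_simps sum.distrib scaleR_sum_right)

lemma tendsto_act:
  assumes "(Ts \<longlongrightarrow> T) F"
  shows "((\<lambda>s. actA X (Ts s)) \<longlongrightarrow> actA X T) F"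
    and "((\<lambda>s. actB X (Ts s)) \<longlongrightarrow> actB X T) F"
    and "((\<lambda>s. actC X (Ts s)) \<longlongrightarrow> actC X T) F"
  using assms by (auto intro!: vec_tendstoI tendsto_intros simp: actA_def actB_def actC_def split: prod.splits)

lemma tendsto_flat:
  assumes "(Ts \<longlongrightarrow> T) F"
  shows "((\<lambda>s. flatA (Ts s) \<alpha>) \<longlongrightarrow> flatA T \<alpha>) F"
    and "((\<lambda>s. flatB (Ts s) \<alpha>) \<longlongrightarrow> flatB T \<alpha>) F"
    and "((\<lambda>s. flatC (Ts s) \<alpha>) \<longlongrightarrow> flatC T \<alpha>) F"
  using assms by (auto intro!: vec_tendstoI tendsto_intros simp: flatA_def flatB_def flatC_def split: prod.splits)

text \<open>
  The slices of \<open>X \<otimes> Id \<otimes> Id\<close> applied to \<open>T\<close> are the images of the rows of \<open>X\<close> under the flattening.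
\<close>

lemma concise_act_inject:
  assumes "concise T"
  shows "actA X T = actA X' T \<Longrightarrow> X = X'"
    and "actB X T = actB X' T \<Longrightarrow> X = X'"
    and "actC X T = actC X' T \<Longrightarrow> X = X'"
proof -
  assume "actA X T = actA X' T"
  then have "flatA T (X $ i) = flatA T (X' $ i)" for i by (simp add: vec_eq_iff)
  with assms show "X = X'" by (simp add: vec_eq_iff[of X X'] concise_def inj_def)
next
  assume "actB X T = actB X' T"
  then have "flatB T (X $ i) = flatB T (X' $ i)" for i by (simp add: vec_eq_iff)
  with assms show "X = X'" by (simp add: vec_eq_iff[of X X'] concise_def inj_def)
next
  assume "actC X T = actC X' T"
  then have "flatC T (X $ i) = flatC T (X' $ i)" for i by (simp add: vec_eq_iff)
  with assms show "X = X'" by (simp add: vec_eq_iff[of X X'] concise_def inj_def)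
qed

text \<open>
  This and its analogues for the other two factors turn the triple intersection in the definition of
  sharpness into the set of tensors that arise from \<open>T\<close> by each of the three actions, that is, into a
  copy of the 111-algebra.
\<close>

lemma tensorA_flatA: "tensorA (range (flatA T)) = range (\<lambda>X. actA X T)"
proof
  have "vec.subspace (range (\<lambda>X. actA X T))"
    by (auto simp: vec.subspace_def act_add[symmetric] act_smult[symmetric] image_iff)
       (metis linear_act(1) linear_0)
  moreover have "vec_lambda (\<lambda>(i, j, k). a $ i * flatA T \<alpha> $ (j, k)) = actA (\<chi> i. a $ i *s \<alpha>) T" for a \<alpha>
    by (simp add: vec_eq_iff sum_distrib_left mult.assoc)
  ultimately show "tensorA (range (flatA T)) \<subseteq> range (\<lambda>X. actA X T)"
    unfolding tensorA_def by (intro vec.span_minimal) auto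
next
  show "range (\<lambda>X. actA X T) \<subseteq> tensorA (range (flatA T))"
  proof clarify
    fix X
    have "actA X T = (\<Sum>r\<in>UNIV. vec_lambda (\<lambda>(i, j, k). axis r 1 $ i * flatA T (X $ r) $ (j, k)))"
      by (simp add: vec_eq_iff axis_def mult_delta_left)
    also have "\<dots> \<in> tensorA (range (flatA T))"
      unfolding tensorA_def by (intro vec.span_sum vec.span_base) blast
    finally show "actA X T \<in> tensorA (range (flatA T))" .
  qed
qed

lemma tensorB_flatB: "tensorB (range (flatB T)) = range (\<lambda>Y. actB Y T)"
proof
  have "vec.subspace (range (\<lambda>X. actB X T))"
    by (auto simp: vec.subspace_def act_add[symmetric] act_smult[symmetric] image_iff)
       (metis linear_act(2) linear_0)
  moreover have "vec_lambda (\<lambda>(i, j, k). a $ j * flatB T \<alpha> $ (i, k)) = actB (\<chi> i. a $ i *s \<alpha>) T" for a \<alpha>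
    by (simp add: vec_eq_iff sum_distrib_left mult.assoc)
  ultimately show "tensorB (range (flatB T)) \<subseteq> range (\<lambda>X. actB X T)"
    unfolding tensorB_def by (intro vec.span_minimal) auto
next
  show "range (\<lambda>X. actB X T) \<subseteq> tensorB (range (flatB T))"
  proof clarify
    fix X
    have "actB X T = (\<Sum>r\<in>UNIV. vec_lambda (\<lambda>(i, j, k). axis r 1 $ j * flatB T (X $ r) $ (i, k)))"
      by (simp add: vec_eq_iff axis_def mult_delta_left)
    also have "\<dots> \<in> tensorB (range (flatB T))"
      unfolding tensorB_def by (intro vec.span_sum vec.span_base) blast
    finally show "actB X T \<in> tensorB (range (flatB T))" .
  qed
qed

lemma tensorC_flatC: "tensorC (range (flatC T)) = range (\<lambda>Z. actC Z T)"
proof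
  have "vec.subspace (range (\<lambda>X. actC X T))"
    by (auto simp: vec.subspace_def act_add[symmetric] act_smult[symmetric] image_iff)
       (metis linear_act(3) linear_0)
  moreover have "vec_lambda (\<lambda>(i, j, k). a $ k * flatC T \<alpha> $ (i, j)) = actC (\<chi> i. a $ i *s \<alpha>) T" for a \<alpha>
    by (simp add: vec_eq_iff sum_distrib_left mult.assoc)
  ultimately show "tensorC (range (flatC T)) \<subseteq> range (\<lambda>X. actC X T)"
    unfolding tensorC_def by (intro vec.span_minimal) auto
next
  show "range (\<lambda>X. actC X T) \<subseteq> tensorC (range (flatC T))"
  proof clarify
    fix X
    have "actC X T = (\<Sum>r\<in>UNIV. vec_lambda (\<lambda>(i, j, k). axis r 1 $ k * flatC T (X $ r) $ (i, j)))"
      by (simp add: vec_eq_iff axis_def mult_delta_left)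
    also have "\<dots> \<in> tensorC (range (flatC T))"
      unfolding tensorC_def by (intro vec.span_sum vec.span_base) blast
    finally show "actC X T \<in> tensorC (range (flatC T))" .
  qed
qed

section \<open>Injectivity in the limit\<close>

text \<open>
  In finite dimension pointwise convergence of linear maps is convergence in operator norm, and a
  perturbation of operator norm at most half the lower bound of \<open>K\<close> preserves the other half.
\<close>

lemma eventually_bounded_below:
  fixes L :: "nat \<Rightarrow> 'a::euclidean_space \<Rightarrow> 'b::euclidean_space"
  assumes lin: "\<And>s. linear (L s)" "linear K" and "inj K"
    and lim: "\<And>x. (\<lambda>s. L s x) \<longlonglongrightarrow> K x"
  obtains c where "c > 0" "\<forall>\<^sub>F s in sequentially. \<forall>x. c * norm x \<le> norm (L s x)"
proof -
  obtain B where B: "B > 0" "\<And>x. B * norm x \<le> norm (K x)"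
    using linear_inj_bounded_below_pos[OF lin(2) \<open>inj K\<close>] by blast
  define \<epsilon> where "\<epsilon> s = (\<Sum>b\<in>Basis. norm (L s b - K b))" for s
  have "\<epsilon> \<longlonglongrightarrow> (\<Sum>b\<in>(Basis::'a set). norm (K b - K b))"
    unfolding \<epsilon>_def by (intro tendsto_intros lim)
  then have "\<epsilon> \<longlonglongrightarrow> 0" by simp
  then have "\<forall>\<^sub>F s in sequentially. \<epsilon> s < B / 2"
    using B(1) by (intro order_tendstoD) auto
  moreover have "B / 2 * norm x \<le> norm (L s x)" if "\<epsilon> s < B / 2" for s x
  proof -
    have "linear (\<lambda>y. L s y - K y)" using lin by (intro linear_compose_sub)
    then have "L s x - K x = (\<Sum>b\<in>Basis. (x \<bullet> b) *\<^sub>R (L s b - K b))"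
      using linear_sum[of "\<lambda>y. L s y - K y" "\<lambda>b. (x \<bullet> b) *\<^sub>R b" Basis]
      by (simp add: euclidean_representation linear_cmul[of "\<lambda>y. L s y - K y"])
    also have "norm \<dots> \<le> (\<Sum>b\<in>Basis. norm x * norm (L s b - K b))"
      by (intro order_trans[OF norm_sum] sum_mono) (auto intro!: mult_right_mono Basis_le_norm)
    also have "\<dots> = norm x * \<epsilon> s" by (simp add: \<epsilon>_def sum_distrib_left)
    also have "\<dots> \<le> norm x * (B / 2)" using that by (intro mult_left_mono) auto
    finally have "norm (K x) - norm (L s x) \<le> norm x * (B / 2)"
      using norm_triangle_ineq2[of "K x" "L s x"] by (simp add: norm_minus_commute)
    with B(2)[of x] show ?thesis by (simp add: algebra_simps)
  qed
  ultimately have "\<forall>\<^sub>F s in sequentially. \<forall>x. B / 2 * norm x \<le> norm (L s x)"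
    by (auto elim: eventually_mono)
  with B(1) show ?thesis by (intro that[of "B / 2"]) auto
qed

section \<open>Sums of as many rank one tensors as the dimension\<close>

definition diag :: "complex ^ 'n \<Rightarrow> complex ^ 'n ^ 'n" where
  "diag v = (\<chi> i j. if i = j then v $ i else 0)"

text \<open>
  The columns of the three matrices are the factors of the rank one summands; the tensor is the image
  of the unit tensor under the triple of matrices.
\<close>

definition diagonal_tensor ::
    "complex ^ 'n ^ 'n \<Rightarrow> complex ^ 'n ^ 'n \<Rightarrow> complex ^ 'n ^ 'n \<Rightarrow> ('n::finite) tensor3" where
  "diagonal_tensor A B C = vec_lambda (\<lambda>(i, j, k). \<Sum>l\<in>UNIV. A $ i $ l * B $ j $ l * C $ k $ l)"

lemma diag_laws:
  fixes v w :: "complex ^ 'n::finite"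
  shows "diag (\<chi> i. v $ i * w $ i) = diag v ** diag w"
    and "diag (\<chi> i. 1) = (mat 1 :: complex ^ 'n ^ 'n)"
  by (auto simp: vec_eq_iff diag_def matrix_matrix_mult_def mat_def mult_delta_left mult_delta_right)

lemma act_diagonal_tensor:
  "actA X (diagonal_tensor A B C) = diagonal_tensor (X ** A) B C"
  "actB X (diagonal_tensor A B C) = diagonal_tensor A (X ** B) C"
  "actC X (diagonal_tensor A B C) = diagonal_tensor A B (X ** C)"
  by (simp_all add: vec_eq_iff diagonal_tensor_def matrix_matrix_mult_def sum_distrib_left
      sum_distrib_right mult_ac) (rule allI, rule allI, rule allI, rule sum.swap)+

text \<open>
  Scaling the summands may be done in any of the three factors.
\<close>

lemma diagonal_tensor_diag:
  "diagonal_tensor (A ** diag v) B C = diagonal_tensor A (B ** diag v) C"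
  "diagonal_tensor (A ** diag v) B C = diagonal_tensor A B (C ** diag v)"
  by (simp_all add: vec_eq_iff diagonal_tensor_def matrix_matrix_mult_def diag_def mult_ac
        mult_delta_left mult_delta_right)

lemma flat_diagonal_tensor_eq_0:
  "\<alpha> v* A = 0 \<Longrightarrow> flatA (diagonal_tensor A B C) \<alpha> = 0"
  "\<alpha> v* B = 0 \<Longrightarrow> flatB (diagonal_tensor A B C) \<alpha> = 0"
  "\<alpha> v* C = 0 \<Longrightarrow> flatC (diagonal_tensor A B C) \<alpha> = 0"
proof -
  have *: "(\<Sum>i\<in>UNIV. \<alpha> $ i * (\<Sum>l\<in>UNIV. M $ i $ l * g l)) = 0" if "\<alpha> v* M = 0"
    for \<alpha> :: "complex ^ 'a" and M :: "complex ^ 'a ^ 'a" and g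
  proof -
    have "(\<Sum>i\<in>UNIV. \<alpha> $ i * (\<Sum>l\<in>UNIV. M $ i $ l * g l)) = (\<Sum>l\<in>UNIV. (\<alpha> v* M) $ l * g l)"
      by (simp add: sum_distrib_left sum_distrib_right vector_matrix_mult_def mult_ac)
         (rule sum.swap)
    with that show ?thesis by simp
  qed
  show "\<alpha> v* A = 0 \<Longrightarrow> flatA (diagonal_tensor A B C) \<alpha> = 0"
    using *[of \<alpha> A "\<lambda>l. B $ _ $ l * C $ _ $ l"]
    by (simp add: vec_eq_iff diagonal_tensor_def mult_ac)
  show "\<alpha> v* B = 0 \<Longrightarrow> flatB (diagonal_tensor A B C) \<alpha> = 0"
    using *[of \<alpha> B "\<lambda>l. A $ _ $ l * C $ _ $ l"]
    by (simp add: vec_eq_iff diagonal_tensor_def mult_ac)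
  show "\<alpha> v* C = 0 \<Longrightarrow> flatC (diagonal_tensor A B C) \<alpha> = 0"
    using *[of \<alpha> C "\<lambda>l. A $ _ $ l * B $ _ $ l"]
    by (simp add: vec_eq_iff diagonal_tensor_def mult_ac)
qed

lemma invertible_if_no_left_kernel:
  fixes A :: "complex ^ 'n ^ 'n::finite"
  assumes "\<And>\<alpha>. \<alpha> v* A = 0 \<Longrightarrow> \<alpha> = 0"
  shows "invertible A"
proof -
  obtain B where "B ** transpose A = mat 1"
    using assms matrix_left_invertible_ker[of "transpose A"] by auto
  then have "A ** transpose B = mat 1"
    by (metis matrix_transpose_mul transpose_mat transpose_transpose)
  then show ?thesis by (auto simp: invertible_right_inverse)
qed

text \<open>
  A vector in the left kernel of one of the factor matrices is killed by the corresponding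
  flattening, while the flattenings are eventually bounded below, being close to injective maps.
\<close>

lemma eventually_invertible_factors:
  fixes T :: "('n::finite) tensor3"
  assumes "concise T" and lim: "(\<lambda>s. diagonal_tensor (A s) (B s) (C s)) \<longlonglongrightarrow> T"
  shows "\<forall>\<^sub>F s in sequentially. invertible (A s) \<and> invertible (B s) \<and> invertible (C s)"
proof -
  define Ts where "Ts s = diagonal_tensor (A s) (B s) (C s)" for s
  note lim' = lim[folded Ts_def]
  obtain a where a: "a > 0" "\<forall>\<^sub>F s in sequentially. \<forall>x. a * norm x \<le> norm (flatA (Ts s) x)"
    using eventually_bounded_below[of "\<lambda>s. flatA (Ts s)" "flatA T"] assms(1)
      linear_flat(1) tendsto_flat(1)[OF lim'] unfolding concise_def by blast
  obtain b where b: "b > 0" "\<forall>\<^sub>F s in sequentially. \<forall>x. b * norm x \<le> norm (flatB (Ts s) x)"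
    using eventually_bounded_below[of "\<lambda>s. flatB (Ts s)" "flatB T"] assms(1)
      linear_flat(2) tendsto_flat(2)[OF lim'] unfolding concise_def by blast
  obtain c where c: "c > 0" "\<forall>\<^sub>F s in sequentially. \<forall>x. c * norm x \<le> norm (flatC (Ts s) x)"
    using eventually_bounded_below[of "\<lambda>s. flatC (Ts s)" "flatC T"] assms(1)
      linear_flat(3) tendsto_flat(3)[OF lim'] unfolding concise_def by blast
  show ?thesis
    using a(2) b(2) c(2)
  proof eventually_elim
    case (elim s)
    have "invertible (A s)"
    proof (rule invertible_if_no_left_kernel)
      fix \<alpha> assume "\<alpha> v* A s = 0"
      with elim(1) a(1) show "\<alpha> = 0"
        using flat_diagonal_tensor_eq_0(1)[of \<alpha> "A s" "B s" "C s"]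
        by (metis Ts_def norm_zero norm_le_zero_iff mult_le_0_iff not_less)
    qed
    moreover have "invertible (B s)"
    proof (rule invertible_if_no_left_kernel)
      fix \<alpha> assume "\<alpha> v* B s = 0"
      with elim(2) b(1) show "\<alpha> = 0"
        using flat_diagonal_tensor_eq_0(2)[of \<alpha> "B s" "A s" "C s"]
        by (metis Ts_def norm_zero norm_le_zero_iff mult_le_0_iff not_less)
    qed
    moreover have "invertible (C s)"
    proof (rule invertible_if_no_left_kernel)
      fix \<alpha> assume "\<alpha> v* C s = 0"
      with elim(3) c(1) show "\<alpha> = 0"
        using flat_diagonal_tensor_eq_0(3)[of \<alpha> "C s" "A s" "B s"]
        by (metis Ts_def norm_zero norm_le_zero_iff mult_le_0_iff not_less)
    qed
    ultimately show ?case by simp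
  qed
qed


section \<open>The 111-algebra\<close>

definition mult3 :: "('n::finite) end3 \<Rightarrow> 'n end3 \<Rightarrow> 'n end3" where
  "mult3 = (\<lambda>(X, Y, Z) (X', Y', Z'). (X ** X', Y ** Y', Z ** Z'))"

definition smult3 :: "complex \<Rightarrow> ('n::finite) end3 \<Rightarrow> 'n end3" where
  "smult3 c = (\<lambda>(X, Y, Z). (\<chi> i. c *s X $ i, \<chi> i. c *s Y $ i, \<chi> i. c *s Z $ i))"

text \<open>
  The 111-algebra is the kernel of this map, which depends continuously on \<open>T\<close>.
\<close>

definition defect111 :: "('n::finite) tensor3 \<Rightarrow> 'n end3 \<Rightarrow> 'n tensor3 \<times> 'n tensor3" where
  "defect111 T = (\<lambda>(X, Y, Z). (actA X T - actB Y T, actB Y T - actC Z T))"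

lemma alg111_simps:
  "carrier (alg111 T) = {w. defect111 T w = 0}"
  "x \<otimes>\<^bsub>alg111 T\<^esub> y = mult3 x y"
  "x \<oplus>\<^bsub>alg111 T\<^esub> y = x + y"
  "\<one>\<^bsub>alg111 T\<^esub> = (mat 1, mat 1, mat 1)"
  "\<zero>\<^bsub>alg111 T\<^esub> = 0"
  "c \<odot>\<^bsub>alg111 T\<^esub> x = smult3 c x"
  by (auto simp: alg111_def defect111_def mult3_def smult3_def zero_prod_def)

lemma linear_defect111: "linear (defect111 T)"
  by (auto intro!: linearI simp: defect111_def act_add linear_cmul[OF linear_act(1)]
      linear_cmul[OF linear_act(2)] linear_cmul[OF linear_act(3)] scaleR_diff_right split: prod.splits)

lemma tendsto_defect111:
  "(Ts \<longlongrightarrow> T) F \<Longrightarrow> ((\<lambda>s. defect111 (Ts s) w) \<longlongrightarrow> defect111 T w) F"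
  by (cases w) (auto simp: defect111_def intro!: tendsto_intros tendsto_act)

text \<open>
  An action in one factor commutes with an action in another, so that each \<open>X\<close> may be moved to the
  factor where it does not interfere. Pushing the second element to the third factor shows that the
  products in the first and in the second factor agree; pushing it to the second factor compares
  the first with the third.
\<close>

lemma alg111_mult_closed:
  assumes "x \<in> carrier (alg111 T)" "y \<in> carrier (alg111 T)"
  shows "mult3 x y \<in> carrier (alg111 T)"
proof -
  obtain X Y Z X' Y' Z' where xy: "x = (X, Y, Z)" "y = (X', Y', Z')"
    by (metis prod_cases3)
  have x: "actA X T = actB Y T" "actB Y T = actC Z T"
    and y: "actA X' T = actB Y' T" "actB Y' T = actC Z' T"
    using assms by (auto simp: alg111_def xy)
  have "actA (X ** X') T = actC Z' (actB Y T)"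
    by (simp add: act_comp y act_commute x(1)[symmetric])
  moreover have "\<dots> = actB (Y ** Y') T"
    by (simp add: act_comp y act_commute)
  moreover have "actA (X ** X') T = actB Y' (actC Z T)"
    by (simp add: act_comp y(1) act_commute x(2)[symmetric] x(1)[symmetric])
  moreover have "\<dots> = actC (Z ** Z') T"
    by (simp add: act_comp y(2)[symmetric] act_commute)
  ultimately show ?thesis by (auto simp: alg111_def xy mult3_def)
qed

text \<open>
  Computed in a single step, with the second element pushed to the second factor, the product in the
  first factor equals the product in the second factor in the opposite order. Conciseness then
  allows the tensor to be cancelled.
\<close>

lemma alg111_mult_commute:
  assumes "concise T" "x \<in> carrier (alg111 T)" "y \<in> carrier (alg111 T)"
  shows "mult3 x y = mult3 y x"
proof -
  obtain X Y Z X' Y' Z' where xy: "x = (X, Y, Z)" "y = (X', Y', Z')"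
    by (metis prod_cases3)
  have x: "actA X T = actB Y T" "actB Y T = actC Z T"
    and y: "actA X' T = actB Y' T" "actB Y' T = actC Z' T"
    using assms by (auto simp: alg111_def xy)
  have "mult3 y x \<in> carrier (alg111 T)" "mult3 x y \<in> carrier (alg111 T)"
    using assms alg111_mult_closed by blast+
  then have c: "actA (X' ** X) T = actB (Y' ** Y) T" "actB (Y' ** Y) T = actC (Z' ** Z) T"
     "actA (X ** X') T = actB (Y ** Y') T" "actB (Y ** Y') T = actC (Z ** Z') T"
    by (auto simp: alg111_def xy mult3_def)
  have e: "actA (X ** X') T = actB (Y' ** Y) T"
    by (simp add: act_comp y(1) act_commute x(1)[symmetric])
  have "X ** X' = X' ** X" using e c(1) by (intro concise_act_inject(1)[OF assms(1)]) metis
  moreover have "Y ** Y' = Y' ** Y" using e c(3) by (intro concise_act_inject(2)[OF assms(1)]) metis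
  moreover have "Z ** Z' = Z' ** Z" using e c(2,3,4) by (intro concise_act_inject(3)[OF assms(1)]) metis
  ultimately show ?thesis by (simp add: xy mult3_def)
qed

lemma mult3_laws:
  "mult3 (mult3 x y) z = mult3 x (mult3 y z)"
  "mult3 (mat 1, mat 1, mat 1) x = x"
  "mult3 (x + y) z = mult3 x z + mult3 y z"
  "mult3 (smult3 c x) y = smult3 c (mult3 x y)"
proof -
  show "mult3 (mult3 x y) z = mult3 x (mult3 y z)"
    by (cases x; cases y; cases z) (simp add: mult3_def matrix_mul_assoc)
  show "mult3 (mat 1, mat 1, mat 1) x = x"
    by (cases x) (simp add: mult3_def)
  show "mult3 (x + y) z = mult3 x z + mult3 y z"
    by (cases x; cases y; cases z)
       (simp add: mult3_def vec_eq_iff matrix_matrix_mult_def distrib_right sum.distrib)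
  show "mult3 (smult3 c x) y = smult3 c (mult3 x y)"
    by (cases x; cases y)
       (simp add: mult3_def smult3_def vec_eq_iff matrix_matrix_mult_def sum_distrib_left mult.assoc)
qed

lemma smult3_laws:
  "smult3 (a + b) x = smult3 a x + smult3 b x"
  "smult3 a (x + y) = smult3 a x + smult3 a y"
  "smult3 (a * b) x = smult3 a (smult3 b x)"
  "smult3 1 x = x"
proof -
  show "smult3 a (x + y) = smult3 a x + smult3 a y"
    by (cases x; cases y) (simp add: smult3_def vec_eq_iff distrib_left)
qed (cases x; simp add: smult3_def vec_eq_iff distrib_right mult.assoc)+

lemma defect111_smult3: "defect111 T w = 0 \<Longrightarrow> defect111 T (smult3 c w) = 0"
  by (auto simp: defect111_def smult3_def act_smult zero_prod_def split: prod.splits)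

lemma ring_of_type_algebra_simps:
  "x \<oplus>\<^bsub>ring_of_type_algebra\<^esub> y = x + y" "x \<otimes>\<^bsub>ring_of_type_algebra\<^esub> y = x * y"
  "\<one>\<^bsub>ring_of_type_algebra\<^esub> = 1"
  by (simp_all add: ring_of_type_algebra_def)

lemma complex_algebra_alg111:
  assumes "concise T"
  shows "complex_algebra (alg111 T)"
proof -
  have ab: "abelian_group (alg111 T)"
  proof (rule abelian_groupI)
    fix x assume "x \<in> carrier (alg111 T)"
    then show "\<exists>y\<in>carrier (alg111 T). y \<oplus>\<^bsub>alg111 T\<^esub> x = \<zero>\<^bsub>alg111 T\<^esub>"
      by (intro bexI[of _ "- x"]) (auto simp: alg111_simps linear_neg[OF linear_defect111])
  qed (auto simp: alg111_simps linear_add[OF linear_defect111] linear_0[OF linear_defect111])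
  have one: "\<one>\<^bsub>alg111 T\<^esub> \<in> carrier (alg111 T)"
    by (simp add: alg111_def act_one)
  have "Group.comm_monoid (alg111 T)"
    by (rule comm_monoidI)
       (use one alg111_mult_closed[of _ T] alg111_mult_commute[OF assms] in
         \<open>auto simp: alg111_simps(2,4) mult3_laws\<close>)
  then have cr: "cring (alg111 T)"
    by (intro cringI ab) (auto simp: alg111_simps(2,3) mult3_laws)
  show ?thesis
    by (rule algebraI[OF cring_from_type_algebra cr])
       (auto simp: alg111_simps smult3_laws mult3_laws ring_of_type_algebra_simps defect111_smult3)
qed

section \<open>Isomorphisms of algebras\<close>

lemma complex_algebra_prod_algebra: "complex_algebra (prod_algebra d)"
proof -
  have ab: "abelian_group (prod_algebra d)"
  proof (rule abelian_groupI)
    fix x assume "x \<in> carrier (prod_algebra d)"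
    then show "\<exists>y\<in>carrier (prod_algebra d). y \<oplus>\<^bsub>prod_algebra d\<^esub> x = \<zero>\<^bsub>prod_algebra d\<^esub>"
      by (intro bexI[of _ "- x"]) (auto simp: prod_algebra_def)
  qed (auto simp: prod_algebra_def)
  have "Group.comm_monoid (prod_algebra d)"
    by (rule comm_monoidI) (auto simp: prod_algebra_def fun_eq_iff)
  then have cr: "cring (prod_algebra d)"
    by (intro cringI ab) (auto simp: prod_algebra_def algebra_simps)
  show ?thesis
    by (rule algebraI[OF cring_from_type_algebra cr])
       (auto simp: prod_algebra_def ring_of_type_algebra_simps algebra_simps)
qed

text \<open>
  The axioms for \<open>N\<close> are carried over from \<open>M\<close> by \<open>h\<close>. This gives the laws of the
  multiplications that are read through linear coordinates.
\<close>

lemma algebra_iso_transport: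
  fixes M :: "(complex, 'v) module" and N :: "(complex, 'w) module"
  assumes M: "complex_algebra M" and bij: "bij_betw h (carrier M) (carrier N)"
    and mult: "\<And>x y. x \<in> carrier M \<Longrightarrow> y \<in> carrier M \<Longrightarrow> h (x \<otimes>\<^bsub>M\<^esub> y) = h x \<otimes>\<^bsub>N\<^esub> h y"
    and add: "\<And>x y. x \<in> carrier M \<Longrightarrow> y \<in> carrier M \<Longrightarrow> h (x \<oplus>\<^bsub>M\<^esub> y) = h x \<oplus>\<^bsub>N\<^esub> h y"
    and one: "h \<one>\<^bsub>M\<^esub> = \<one>\<^bsub>N\<^esub>" and zero: "h \<zero>\<^bsub>M\<^esub> = \<zero>\<^bsub>N\<^esub>"
    and smult: "\<And>c x. x \<in> carrier M \<Longrightarrow> h (c \<odot>\<^bsub>M\<^esub> x) = c \<odot>\<^bsub>N\<^esub> h x"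
  shows "algebra_iso M N"
proof -
  interpret M: Module.algebra "ring_of_type_algebra :: complex ring" M by fact
  have h: "h \<in> ring_iso M N"
    using bij mult add one by (intro ring_iso_memI) (auto simp: bij_betw_def)
  have cr: "cring N"
    using M.ring_iso_imp_img_cring[OF h] by (simp add: zero)
  have N: "carrier N = h ` carrier M" using bij by (simp add: bij_betw_def)
  have all: "c \<in> carrier (ring_of_type_algebra :: complex ring)" for c
    by (simp add: ring_of_type_algebra_def)
  note [simp] = mult[symmetric] add[symmetric] smult[symmetric]
  have "complex_algebra N"
    by (rule algebraI[OF cring_from_type_algebra cr])
       (auto simp: N all M.smult_l_distr M.smult_r_distr M.smult_assoc1 M.smult_assoc2)
  with M h smult show ?thesis unfolding algebra_iso_def by blast
qed

lemma algebra_iso_sym: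
  assumes "algebra_iso M N"
  shows "algebra_iso N M"
proof -
  obtain h where h: "h \<in> ring_iso M N" and smult: "\<And>c x. x \<in> carrier M \<Longrightarrow> h (c \<odot>\<^bsub>M\<^esub> x) = c \<odot>\<^bsub>N\<^esub> h x"
    and alg: "complex_algebra M" "complex_algebra N"
    using assms by (auto simp: algebra_iso_def)
  interpret M: Module.algebra "ring_of_type_algebra :: complex ring" M by fact
  let ?g = "inv_into (carrier M) h"
  have bij: "bij_betw h (carrier M) (carrier N)" using h by (rule ring_iso_memE)
  have "?g \<in> ring_iso N M" by (rule ring_iso_set_sym[OF M.ring_axioms h])
  moreover have "?g (c \<odot>\<^bsub>N\<^esub> y) = c \<odot>\<^bsub>M\<^esub> ?g y" if y: "y \<in> carrier N" for c y
  proof -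
    obtain x where x: "x \<in> carrier M" "y = h x" using y bij by (auto simp: bij_betw_def)
    have "c \<odot>\<^bsub>M\<^esub> x \<in> carrier M" using x by (simp add: ring_of_type_algebra_def)
    then show ?thesis
      using x bij smult[OF x(1), of c, symmetric] by (simp add: bij_betw_def)
  qed
  ultimately show ?thesis using alg by (auto simp: algebra_iso_def)
qed

section \<open>The 111-algebra of a sum of rank one tensors\<close>

text \<open>
  The triple of operators with eigenvalue \<open>v $ l\<close> on the \<open>l\<close>-th columns of \<open>A\<close>, \<open>B\<close> and \<open>C\<close>,
  when these columns form bases.
\<close>

definition conj_diag ::
    "complex ^ 'n ^ 'n \<Rightarrow> complex ^ 'n ^ 'n \<Rightarrow> complex ^ 'n ^ 'n \<Rightarrow> complex ^ 'n \<Rightarrow> ('n::finite) end3" where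
  "conj_diag A B C v =
     (A ** diag v ** matrix_inv A, B ** diag v ** matrix_inv B, C ** diag v ** matrix_inv C)"

lemma conj_diag_add: "conj_diag A B C (v + w) = conj_diag A B C v + conj_diag A B C w"
  by (simp add: conj_diag_def vec_eq_iff matrix_matrix_mult_def diag_def mult_delta_right
      distrib_left distrib_right sum.distrib)

lemma conj_diag_smult: "conj_diag A B C (c *s v) = smult3 c (conj_diag A B C v)"
  by (simp add: conj_diag_def smult3_def vec_eq_iff matrix_matrix_mult_def diag_def mult_delta_right
      sum_distrib_left mult_ac)

lemma linear_conj_diag: "linear (conj_diag A B C)"
proof (rule linearI)
  show "conj_diag A B C (r *\<^sub>R v) = r *\<^sub>R conj_diag A B C v" for r v
    unfolding scaleR_eq_smult conj_diag_smult
    by (simp add: smult3_def conj_diag_def scaleR_eq_smult[symmetric]) (simp add: vec_eq_iff)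
qed (rule conj_diag_add)

lemma matrix_inv_cancel:
  assumes "invertible A"
  shows "A ** matrix_inv A = mat 1" "matrix_inv A ** A = mat 1"
  using someI_ex[OF assms[unfolded invertible_def]] by (auto simp: matrix_inv_def)

lemma conj_diag_mult:
  fixes A B C :: "complex ^ 'n ^ 'n::finite"
  assumes "invertible A" "invertible B" "invertible C"
  shows "conj_diag A B C (\<chi> i. v $ i * w $ i) = mult3 (conj_diag A B C v) (conj_diag A B C w)"
proof -
  have "P ** (diag v ** diag w) ** matrix_inv P = P ** diag v ** matrix_inv P ** (P ** diag w ** matrix_inv P)"
    if "invertible P" for P :: "complex ^ 'n ^ 'n"
    by (metis matrix_inv_cancel(2)[OF that] matrix_mul_assoc matrix_mul_rid)
  with assms show ?thesis by (simp add: conj_diag_def mult3_def diag_laws(1))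
qed

lemma conj_diag_one:
  assumes "invertible A" "invertible B" "invertible C"
  shows "conj_diag A B C (\<chi> i. 1) = (mat 1, mat 1, mat 1)"
  using assms by (simp add: conj_diag_def diag_laws(2) matrix_inv_cancel(1))

lemma inj_conj_diag:
  assumes "invertible A"
  shows "inj (conj_diag A B C)"
  unfolding linear_injective_0[OF linear_conj_diag]
proof (intro allI impI)
  fix v assume 0: "conj_diag A B C v = 0"
  have "A ** diag v ** matrix_inv A = 0"
    using 0 by (simp add: conj_diag_def zero_prod_def)
  then have "matrix_inv A ** (A ** diag v ** matrix_inv A) ** A = 0" by simp
  moreover have "matrix_inv A ** (A ** diag v ** matrix_inv A) ** A = diag v"
    by (metis matrix_inv_cancel(2)[OF assms] matrix_mul_assoc matrix_mul_rid matrix_mul_lid)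
  ultimately show "v = 0" by (simp add: vec_eq_iff diag_def) (metis)
qed

text \<open>
  Each of the three operators multiplies the \<open>l\<close>-th rank one summand by \<open>v $ l\<close>.
\<close>

lemma defect111_conj_diag:
  fixes A B C :: "complex ^ 'n ^ 'n::finite"
  assumes "invertible A" "invertible B" "invertible C"
  shows "defect111 (diagonal_tensor A B C) (conj_diag A B C v) = 0"
proof -
  have "P ** diag v ** matrix_inv P ** P = P ** diag v" if "invertible P" for P :: "complex ^ 'n ^ 'n"
    by (metis matrix_inv_cancel(2)[OF that] matrix_mul_assoc matrix_mul_rid)
  note this[OF assms(1)] this[OF assms(2)] this[OF assms(3)]
  then show ?thesis
    using diagonal_tensor_diag[of A v B C]
    by (simp add: defect111_def conj_diag_def act_diagonal_tensor zero_prod_def)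
qed

section \<open>Convergence of the 111-algebras\<close>

text \<open>
  Acting on \<open>T\<close> by its first component maps an element of the 111-algebra to the triple
  intersection; by conciseness this is a bijection, and by sharpness the intersection is isomorphic
  to the coordinate space.
\<close>

lemma sharp111_coordinates:
  fixes T :: "('n::finite) tensor3"
  assumes "concise T" "sharp111 T"
  obtains Q :: "'n end3 \<Rightarrow> complex ^ 'n"
  where "linear Q" "\<And>c w. Q (smult3 c w) = c *s Q w" "bij_betw Q (carrier (alg111 T)) UNIV"
proof -
  define V where "V = tensorA (range (flatA T)) \<inter> tensorB (range (flatB T)) \<inter> tensorC (range (flatC T))"
  have "vec.subspace V"
    unfolding V_def tensorA_def tensorB_def tensorC_def
    by (intro vec.subspace_inter vec.subspace_span)
  moreover have "vec.dim V = vec.dim (UNIV :: (complex ^ 'n) set)"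
    using assms(2) unfolding vec_dim_card by (simp add: sharp111_def V_def)
  ultimately obtain f :: "'n tensor3 \<Rightarrow> complex ^ 'n"
    where f: "Vector_Spaces.linear (*s) (*s) f" "f ` V = UNIV" "inj_on f V"
    using vec.subspace_isomorphism[of V UNIV] by auto
  define Q where "Q w = f (actA (fst w) T)" for w :: "'n end3"
  have f_add: "f (x + y) = f x + f y" and f_smult: "f (c *s x) = c *s f x" for c x y
    using f(1) by (auto simp: Vector_Spaces.linear_iff)
  have V: "V = range (\<lambda>X. actA X T) \<inter> range (\<lambda>Y. actB Y T) \<inter> range (\<lambda>Z. actC Z T)"
    by (simp add: V_def tensorA_flatA tensorB_flatB tensorC_flatC)
  show ?thesis
  proof
    \<comment> \<open>linearity over the reals, which follows from linearity over the complex numbers\<close>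
    show "linear Q"
      by (rule linearI)
         (simp_all add: Q_def act_add f_add linear_cmul[OF linear_act(1)] scaleR_eq_smult[where v="actA _ _"]
            f_smult, simp add: scaleR_eq_smult)
    show "Q (smult3 c w) = c *s Q w" for c w
      by (cases w) (simp add: Q_def smult3_def act_smult f_smult)
    show "bij_betw Q (carrier (alg111 T)) UNIV"
    proof (rule bij_betw_imageI)
      show "inj_on Q (carrier (alg111 T))"
      proof (rule inj_onI)
        fix w w' assume w: "w \<in> carrier (alg111 T)" "w' \<in> carrier (alg111 T)" and eq: "Q w = Q w'"
        obtain X Y Z X' Y' Z' where ww: "w = (X, Y, Z)" "w' = (X', Y', Z')"
          by (metis prod_cases3)
        have x: "actA X T = actB Y T" "actA X T = actC Z T"
          and y: "actA X' T = actB Y' T" "actA X' T = actC Z' T"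
          using w by (auto simp: alg111_def ww)
        have "actA X T \<in> V" "actA X' T \<in> V"
          unfolding V using x y by (metis IntI rangeI)+
        with eq f(3) have "actA X T = actA X' T" by (auto simp: Q_def ww inj_on_def)
        with x y have "actB Y T = actB Y' T" "actC Z T = actC Z' T" by metis+
        with \<open>actA X T = actA X' T\<close> show "w = w'"
          using concise_act_inject[OF assms(1)] ww by blast
      qed
      show "Q ` carrier (alg111 T) = UNIV"
      proof (intro equalityI subset_UNIV subsetI)
        fix v
        from f(2) obtain U where U: "U \<in> V" "v = f U" by (metis UNIV_I image_iff)
        then obtain X Y Z where "U = actA X T" "U = actB Y T" "U = actC Z T"
          unfolding V by blast
        with U have "(X, Y, Z) \<in> carrier (alg111 T)" "v = Q (X, Y, Z)"
          by (simp_all add: alg111_def Q_def)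
        then show "v \<in> Q ` carrier (alg111 T)" by blast
      qed
    qed
  qed
qed

text \<open>
  Both claims come from one estimate. Let \<open>L s\<close> consist of the defining equations of the 111-algebra
  of \<open>Ts s\<close> together with the coordinates \<open>Q\<close>; it is uniformly bounded below because its limit is
  injective. An element in the image of \<open>h s\<close> with vanishing coordinates is annihilated by \<open>L s\<close>, hence
  zero. The element in the image of \<open>h s\<close> with the same coordinates as \<open>w\<close> differs from \<open>w\<close> by at most a
  constant times the amount by which \<open>w\<close> fails the equations for \<open>Ts s\<close>, and this amount tends to
  zero.
\<close>

lemma alg111_inverse_limit:
  fixes T :: "('n::finite) tensor3" and h :: "nat \<Rightarrow> complex ^ 'n \<Rightarrow> 'n end3"
    and Q :: "'n end3 \<Rightarrow> complex ^ 'n"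
  assumes Q: "linear Q" "inj_on Q (carrier (alg111 T))" and lim: "Ts \<longlonglongrightarrow> T"
    and h: "\<And>s. linear (h s)" "\<And>s. inj (h s)" "\<And>s v. defect111 (Ts s) (h s v) = 0"
  shows "\<forall>\<^sub>F s in sequentially. bij (Q \<circ> h s)"
    and "w \<in> carrier (alg111 T) \<Longrightarrow> (\<lambda>s. h s (inv_into UNIV (Q \<circ> h s) (Q w))) \<longlonglongrightarrow> w"
proof -
  define L where "L s w = (defect111 (Ts s) w, Q w)" for s w
  have L: "linear (L s)" for s
    by (rule linearI) (simp_all add: L_def linear_add[OF linear_defect111] linear_cmul[OF linear_defect111]
        linear_add[OF Q(1)] linear_cmul[OF Q(1)])
  have K: "linear (\<lambda>w. (defect111 T w, Q w))"
    by (rule linearI) (simp_all add: linear_add[OF linear_defect111] linear_cmul[OF linear_defect111]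
        linear_add[OF Q(1)] linear_cmul[OF Q(1)])
  have "w = 0" if "defect111 T w = 0" "Q w = 0" for w
    using that inj_onD[OF Q(2), of w 0]
    by (simp add: alg111_simps linear_0[OF Q(1)] linear_0[OF linear_defect111])
  then have "inj (\<lambda>w. (defect111 T w, Q w))"
    unfolding linear_injective_0[OF K] by (simp add: zero_prod_def)
  moreover have "(\<lambda>s. L s w) \<longlonglongrightarrow> (defect111 T w, Q w)" for w
    unfolding L_def by (intro tendsto_intros tendsto_defect111 lim)
  ultimately obtain c where c: "c > 0" "\<forall>\<^sub>F s in sequentially. \<forall>w. c * norm w \<le> norm (L s w)"
    using eventually_bounded_below[of L, OF L K] by blast
  have bij: "bij (Q \<circ> h s)" if "\<forall>w. c * norm w \<le> norm (L s w)" for s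
  proof -
    have lin: "linear (Q \<circ> h s)" by (intro linear_compose h Q)
    have "v = 0" if "(Q \<circ> h s) v = 0" for v
    proof -
      have "L s (h s v) = 0" using that h(3) by (simp add: L_def zero_prod_def)
      with \<open>\<forall>w. _\<close> have "c * norm (h s v) \<le> 0" by (metis norm_zero)
      with c(1) have "h s v = 0" by (simp add: mult_le_0_iff)
      then show "v = 0" using h(2) by (simp add: linear_injective_0[OF h(1)])
    qed
    then have "inj (Q \<circ> h s)" unfolding linear_injective_0[OF lin] by blast
    moreover have "surj (Q \<circ> h s)" using lin calculation by (rule linear_injective_imp_surjective) simp
    ultimately show ?thesis by (simp add: bij_def)
  qed
  with c(2) show "\<forall>\<^sub>F s in sequentially. bij (Q \<circ> h s)" by (auto elim: eventually_mono)
  show "(\<lambda>s. h s (inv_into UNIV (Q \<circ> h s) (Q w))) \<longlonglongrightarrow> w" if w: "w \<in> carrier (alg111 T)"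
  proof -
    let ?w = "\<lambda>s. h s (inv_into UNIV (Q \<circ> h s) (Q w))"
    have "norm (?w s - w) \<le> norm (defect111 (Ts s) w) / c" if s: "\<forall>w. c * norm w \<le> norm (L s w)" for s
    proof -
      have "(Q \<circ> h s) (inv_into UNIV (Q \<circ> h s) (Q w)) = Q w"
        by (rule surj_f_inv_f[OF bij_is_surj[OF bij[OF s]]])
      then have "L s (?w s - w) = (- defect111 (Ts s) w, 0)"
        unfolding linear_diff[OF L] by (simp add: L_def h(3))
      then have "c * norm (?w s - w) \<le> norm (defect111 (Ts s) w)"
        using s[rule_format, of "?w s - w"] by (simp add: norm_Pair)
      with c(1) show ?thesis by (simp add: field_simps)
    qed
    with c(2) have "\<forall>\<^sub>F s in sequentially. norm (?w s - w) \<le> norm (defect111 (Ts s) w) / c"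
      by (auto elim: eventually_mono)
    moreover have "(\<lambda>s. norm (defect111 (Ts s) w) / c) \<longlonglongrightarrow> norm (defect111 T w) / c"
      by (intro tendsto_intros tendsto_defect111 lim) (use c in auto)
    ultimately have "(\<lambda>s. ?w s - w) \<longlonglongrightarrow> 0"
      using w by (intro Lim_null_comparison[of "\<lambda>s. ?w s - w"]) (auto simp: alg111_simps)
    then show ?thesis by (rule LIM_zero_cancel)
  qed
qed

section \<open>Tensors of minimal border rank\<close>

text \<open>
  This guarantees that the least number in the definition of the border rank exists. The summands
  are the multiples of the standard basis tensors at the nonzero entries of \<open>T\<close>.
\<close>

lemma sum_of_rank_ones_exists:
  fixes T :: "('n::finite) tensor3"
  shows "\<exists>r R. (\<forall>l<r. rank_one (R l)) \<and> T = (\<Sum>l<(r::nat). R l)"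
proof -
  define S where "S = {p. T $ p \<noteq> 0}"
  define g :: "'n \<times> 'n \<times> 'n \<Rightarrow> 'n tensor3"
    where "g = (\<lambda>(i, j, k). pure3 (axis i (T $ (i, j, k))) (axis j 1) (axis k 1))"
  obtain e where e: "bij_betw e {..<card S} S"
    using ex_bij_betw_nat_finite[of S] by (auto simp: atLeast0LessThan)
  have "rank_one (g p)" if "p \<in> S" for p
  proof -
    obtain i j k where p: "p = (i, j, k)" by (rule prod_cases3)
    then have "axis i (T $ p) \<noteq> 0" "axis j (1 :: complex) \<noteq> 0" "axis k (1 :: complex) \<noteq> 0"
      using that by (simp_all add: S_def axis_eq_0_iff)
    moreover have "g p = pure3 (axis i (T $ p)) (axis j 1) (axis k 1)" by (simp add: g_def p)
    ultimately show ?thesis unfolding rank_one_def by blast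
  qed
  then have "\<forall>l<card S. rank_one (g (e l))"
    using bij_betwE[OF e] by blast
  moreover have "g p $ q = (if p = q then T $ p else 0)" for p q
    by (cases p; cases q) (auto simp: g_def pure3_def axis_def)
  then have "(\<Sum>p\<in>S. g p) $ q = T $ q" for q
    by (simp add: sum.delta S_def)
  then have "T = (\<Sum>p\<in>S. g p)" by (simp add: vec_eq_iff del: split_paired_All)
  then have "T = (\<Sum>l<card S. g (e l))"
    by (simp only: sum.reindex_bij_betw[OF e])
  ultimately show ?thesis
    by (intro exI[of _ "card S"] exI[of _ "\<lambda>l. g (e l)"] conjI)
qed

lemma minimal_border_rank_limit:
  fixes T :: "('n::finite) tensor3"
  assumes "minimal_border_rank T"
  obtains A B C where "(\<lambda>s::nat. diagonal_tensor (A s) (B s) (C s)) \<longlonglongrightarrow> T"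
proof -
  define rank_sums :: "nat \<Rightarrow> 'n tensor3 set"
    where "rank_sums r = {\<Sum>l<r. R l |R. \<forall>l<r. rank_one (R l)}" for r
  obtain r R where "\<forall>l<r. rank_one (R l)" "T = (\<Sum>l<(r::nat). R l)"
    using sum_of_rank_ones_exists[of T] by metis
  then have "T \<in> rank_sums r" unfolding rank_sums_def by (intro CollectI exI[of _ R] conjI)
  then have "T \<in> closure (rank_sums r)" by (rule subsetD[OF closure_subset])
  then have "\<exists>r. T \<in> closure (rank_sums r)" ..
  then have "T \<in> closure (rank_sums (border_rank T))"
    unfolding border_rank_def rank_sums_def[symmetric] by (rule LeastI_ex)
  then have "T \<in> closure (rank_sums CARD('n))"
    using assms by (simp add: minimal_border_rank_def)
  then obtain Ts where Ts: "\<And>s. Ts s \<in> rank_sums CARD('n)" "Ts \<longlonglongrightarrow> T"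
    unfolding closure_sequential by blast
  obtain e :: "'n \<Rightarrow> nat" where e: "bij_betw e UNIV {..<CARD('n)}"
    using ex_bij_betw_finite_nat[of "UNIV :: 'n set"] by (auto simp: atLeast0LessThan)
  have "\<exists>A B C. Ts s = diagonal_tensor A B C" for s
  proof -
    obtain R where R: "\<forall>l<CARD('n). rank_one (R l)" "Ts s = (\<Sum>l<CARD('n). R l)"
      using Ts(1)[of s] unfolding rank_sums_def by blast
    then obtain a b c where "\<forall>l<CARD('n). R l = pure3 (a l) (b l) (c l)"
      unfolding rank_one_def by metis
    then have "Ts s = (\<Sum>l<CARD('n). pure3 (a l) (b l) (c l))"
      using R(2) by simp
    also have "\<dots> = (\<Sum>l\<in>UNIV. pure3 (a (e l)) (b (e l)) (c (e l)))"
      by (rule sum.reindex_bij_betw[OF e, symmetric])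
    also have "\<dots> = diagonal_tensor (\<chi> i l. a (e l) $ i) (\<chi> i l. b (e l) $ i) (\<chi> i l. c (e l) $ i)"
      by (simp add: vec_eq_iff diagonal_tensor_def pure3_def)
    finally show ?thesis by blast
  qed
  then obtain A B C where "\<And>s. Ts s = diagonal_tensor (A s) (B s) (C s)" by metis
  with Ts(2) have "(\<lambda>s. diagonal_tensor (A s) (B s) (C s)) \<longlonglongrightarrow> T"
    by (metis (no_types, lifting) ext)
  then show ?thesis by (rule that)
qed

section \<open>Smoothability\<close>

lemma tendsto_mult3:
  fixes f g :: "'b \<Rightarrow> ('a::finite) end3"
  assumes "(f \<longlongrightarrow> x) F" "(g \<longlongrightarrow> y) F"
  shows "((\<lambda>s. mult3 (f s) (g s)) \<longlongrightarrow> mult3 x y) F"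
proof -
  have mult3: "mult3 x y = (fst x ** fst y, fst (snd x) ** fst (snd y), snd (snd x) ** snd (snd y))"
    for x y :: "'a end3" by (simp add: mult3_def split: prod.splits)
  have mm: "((\<lambda>s. M s ** N s) \<longlongrightarrow> M' ** N') F" if "(M \<longlongrightarrow> M') F" "(N \<longlongrightarrow> N') F"
    for M N and M' N' :: "complex ^ 'a ^ 'a"
    unfolding matrix_matrix_mult_def by (auto intro!: vec_tendstoI tendsto_intros that)
  show ?thesis unfolding mult3 by (intro tendsto_intros mm assms)
qed

text \<open>
  Translation between vectors indexed by a finite type and the functions on the natural numbers that
  carry the algebras in the definition of smoothability; \<open>e\<close> is an enumeration of the index type.
\<close>

definition tuple_of_vec :: "('n \<Rightarrow> nat) \<Rightarrow> complex ^ 'n::finite \<Rightarrow> nat \<Rightarrow> complex" where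
  "tuple_of_vec e v k = (if k \<in> range e then v $ inv_into UNIV e k else 0)"

definition vec_of_tuple :: "('n \<Rightarrow> nat) \<Rightarrow> (nat \<Rightarrow> complex) \<Rightarrow> complex ^ 'n::finite" where
  "vec_of_tuple e x = (\<chi> i. x (e i))"

lemma vec_of_tuple_of_vec: "inj e \<Longrightarrow> vec_of_tuple e (tuple_of_vec e v) = v"
  by (simp add: vec_of_tuple_def tuple_of_vec_def vec_eq_iff)

lemma tuple_of_vec_of_tuple:
  assumes "bij_betw e UNIV {..<d}" "x \<in> carrier (prod_algebra d)"
  shows "tuple_of_vec e (vec_of_tuple e x) = x"
  using assms
  by (auto simp: bij_betw_def prod_algebra_def tuple_of_vec_def vec_of_tuple_def fun_eq_iff f_inv_into_f)

lemma bij_betw_tuple_vec: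
  assumes "bij_betw e UNIV {..<d}"
  shows "bij_betw (tuple_of_vec e) UNIV (carrier (prod_algebra d))"
    and "bij_betw (vec_of_tuple e) (carrier (prod_algebra d)) UNIV"
proof -
  have "inj e" "range e = {..<d}" using assms by (auto simp: bij_betw_def)
  then have vec: "\<forall>v\<in>UNIV. vec_of_tuple e (tuple_of_vec e v) = v"
    and closed: "tuple_of_vec e ` UNIV \<subseteq> carrier (prod_algebra d)"
    by (auto simp: vec_of_tuple_of_vec prod_algebra_def tuple_of_vec_def)
  have tuple: "\<forall>x\<in>carrier (prod_algebra d). tuple_of_vec e (vec_of_tuple e x) = x"
    using tuple_of_vec_of_tuple[OF assms] by blast
  show "bij_betw (tuple_of_vec e) UNIV (carrier (prod_algebra d))"
    by (rule bij_betw_byWitness[OF vec tuple closed]) simp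
  show "bij_betw (vec_of_tuple e) (carrier (prod_algebra d)) UNIV"
    by (rule bij_betw_byWitness[OF tuple vec _ closed]) simp
qed

lemma tuple_of_vec_laws:
  "tuple_of_vec e (v + w) = (\<lambda>i. tuple_of_vec e v i + tuple_of_vec e w i)"
  "tuple_of_vec e (c *s v) = (\<lambda>i. c * tuple_of_vec e v i)"
  "tuple_of_vec e 0 = (\<lambda>i. 0)"
  by (auto simp: tuple_of_vec_def)

lemma based_algebra_simps:
  "carrier (based_algebra d \<mu> u) = carrier (prod_algebra d)"
  "x \<otimes>\<^bsub>based_algebra d \<mu> u\<^esub> y = \<mu> x y"
  "x \<oplus>\<^bsub>based_algebra d \<mu> u\<^esub> y = (\<lambda>i. x i + y i)"
  "\<one>\<^bsub>based_algebra d \<mu> u\<^esub> = u"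
  "\<zero>\<^bsub>based_algebra d \<mu> u\<^esub> = (\<lambda>i. 0)"
  "c \<odot>\<^bsub>based_algebra d \<mu> u\<^esub> x = (\<lambda>i. c * x i)"
  by (simp_all add: based_algebra_def prod_algebra_def)

theorem lemma5p7:
  fixes T :: "('n::finite) tensor3"
  assumes "concise T"
    and "sharp111 T"
    and "minimal_border_rank T"
  shows "smoothable (alg111 T)"
proof -
  obtain A0 B0 C0 where lim0: "(\<lambda>s::nat. diagonal_tensor (A0 s) (B0 s) (C0 s)) \<longlonglongrightarrow> T"
    using minimal_border_rank_limit[OF assms(3)] .
  obtain N where N: "\<And>s. s \<ge> N \<Longrightarrow> invertible (A0 s) \<and> invertible (B0 s) \<and> invertible (C0 s)"
    using eventually_invertible_factors[OF assms(1) lim0] unfolding eventually_sequentially by blast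
  define Ts where "Ts s = diagonal_tensor (A0 (s + N)) (B0 (s + N)) (C0 (s + N))" for s
  define h where "h s = conj_diag (A0 (s + N)) (B0 (s + N)) (C0 (s + N))" for s
  have lim: "Ts \<longlonglongrightarrow> T"
    using LIMSEQ_ignore_initial_segment[OF lim0, of N] by (simp add: Ts_def[abs_def])
  have inv: "invertible (A0 (s + N))" "invertible (B0 (s + N))" "invertible (C0 (s + N))" for s
    using N[of "s + N"] by auto
  have h: "linear (h s)" "inj (h s)" "defect111 (Ts s) (h s v) = 0" for s v
    unfolding h_def Ts_def
    by (fact linear_conj_diag, rule inj_conj_diag[OF inv(1)], rule defect111_conj_diag[OF inv])
  obtain Q :: "'n end3 \<Rightarrow> complex ^ 'n" where Q: "linear Q" "\<And>c w. Q (smult3 c w) = c *s Q w"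
      "bij_betw Q (carrier (alg111 T)) UNIV"
    using sharp111_coordinates[OF assms(1,2)] by blast
  note limit = alg111_inverse_limit[where h = h, OF Q(1) bij_betw_imp_inj_on[OF Q(3)] lim h]
  obtain N' where N': "\<And>s. s \<ge> N' \<Longrightarrow> bij (Q \<circ> h s)"
    using limit(1) unfolding eventually_sequentially by blast
  \<comment> \<open>the inverses of the coordinates \<open>Q\<close> on the approximating algebras and on the 111-algebra of \<open>T\<close>\<close>
  define g where "g s v = h (s + N') (inv_into UNIV (Q \<circ> h (s + N')) v)" for s v
  define \<phi> where "\<phi> = inv_into (carrier (alg111 T)) Q"
  have Q\<phi>: "Q (\<phi> v) = v" and \<phi>Q: "w \<in> carrier (alg111 T) \<Longrightarrow> \<phi> (Q w) = w"
    and \<phi>: "\<phi> v \<in> carrier (alg111 T)" for v w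
    using Q(3) unfolding \<phi>_def
    by (auto simp: bij_betw_def f_inv_into_f inv_into_into)
  have g: "(\<lambda>s. g s v) \<longlonglongrightarrow> \<phi> v" for v
    using LIMSEQ_ignore_initial_segment[OF limit(2)[OF \<phi>[of v]], of N'] by (simp add: g_def Q\<phi>)
  have gQ: "g s (Q (h (s + N') v)) = h (s + N') v" for s v
    using inv_f_f[OF bij_is_inj[OF N'[of "s + N'"]], of v] by (simp add: g_def)
  obtain e :: "'n \<Rightarrow> nat" where e: "bij_betw e UNIV {..<CARD('n)}"
    using ex_bij_betw_finite_nat[of "UNIV :: 'n set"] by (auto simp: atLeast0LessThan)
  then have "inj e" by (simp add: bij_betw_def)
  define d where "d = CARD('n)"
  \<comment> \<open>the multiplications of the 111-algebra and of the approximating algebras, read through \<open>Q\<close>\<close>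
  define \<mu> where "\<mu> x y = tuple_of_vec e (Q (mult3 (\<phi> (vec_of_tuple e x)) (\<phi> (vec_of_tuple e y))))" for x y
  define \<mu>s where "\<mu>s s x y = tuple_of_vec e (Q (mult3 (g s (vec_of_tuple e x)) (g s (vec_of_tuple e y))))"
    for s x y
  \<comment> \<open>the isomorphism from the product of copies of the complex numbers to the approximating algebra\<close>
  define F where "F s = tuple_of_vec e \<circ> ((Q \<circ> h (s + N')) \<circ> vec_of_tuple e)" for s
  \<comment> \<open>the identity triple lies in all the algebras, so that the units form a constant sequence\<close>
  define u where "u = tuple_of_vec e (Q (mat 1, mat 1, mat 1))"
  note bij = bij_betw_tuple_vec[OF e, folded d_def]
  have "algebra_iso (alg111 T) (based_algebra d \<mu> u)"
  proof (rule algebra_iso_transport[where h = "tuple_of_vec e \<circ> Q"])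
    show "bij_betw (tuple_of_vec e \<circ> Q) (carrier (alg111 T)) (carrier (based_algebra d \<mu> u))"
      unfolding based_algebra_simps by (rule bij_betw_trans[OF Q(3) bij(1)])
  qed (simp_all add: complex_algebra_alg111[OF assms(1)] based_algebra_simps alg111_simps(2-6) \<mu>_def u_def
      vec_of_tuple_of_vec[OF \<open>inj e\<close>] \<phi>Q tuple_of_vec_laws linear_add[OF Q(1)] linear_0[OF Q(1)] Q(2))
  moreover have "algebra_iso (based_algebra d (\<mu>s s) u) (prod_algebra d)" for s
  proof (rule algebra_iso_sym, rule algebra_iso_transport[where h = "F s"])
    show "bij_betw (F s) (carrier (prod_algebra d)) (carrier (based_algebra d (\<mu>s s) u))"
      unfolding based_algebra_simps F_def
      by (rule bij_betw_trans[OF bij_betw_trans[OF bij(2) N'] bij(1)]) simp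
    have h_laws: "h s (\<chi> i. v $ i * w $ i) = mult3 (h s v) (h s w)" "h s (\<chi> i. 1) = (mat 1, mat 1, mat 1)"
      "h s (v + w) = h s v + h s w" "h s (c *s v) = smult3 c (h s v)" "h s 0 = 0" for s v w c
      using inv[of s] linear_0[OF h(1)]
      by (simp_all add: h_def conj_diag_mult conj_diag_one conj_diag_add conj_diag_smult)
    note simps = F_def based_algebra_simps \<mu>s_def u_def vec_of_tuple_of_vec[OF \<open>inj e\<close>] gQ tuple_of_vec_laws
    fix x y c
    show "F s (x \<otimes>\<^bsub>prod_algebra d\<^esub> y) = F s x \<otimes>\<^bsub>based_algebra d (\<mu>s s) u\<^esub> F s y"
      using h_laws(1)[of "s + N'" "vec_of_tuple e x" "vec_of_tuple e y"]
      by (simp add: simps) (simp add: vec_of_tuple_def prod_algebra_def)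
    show "F s (x \<oplus>\<^bsub>prod_algebra d\<^esub> y) = F s x \<oplus>\<^bsub>based_algebra d (\<mu>s s) u\<^esub> F s y"
    proof -
      have "vec_of_tuple e (x \<oplus>\<^bsub>prod_algebra d\<^esub> y) = vec_of_tuple e x + vec_of_tuple e y"
        by (simp add: vec_of_tuple_def prod_algebra_def vec_eq_iff)
      then show ?thesis by (simp add: simps h_laws linear_add[OF Q(1)])
    qed
    show "F s (c \<odot>\<^bsub>prod_algebra d\<^esub> x) = c \<odot>\<^bsub>based_algebra d (\<mu>s s) u\<^esub> F s x"
    proof -
      have "vec_of_tuple e (c \<odot>\<^bsub>prod_algebra d\<^esub> x) = c *s vec_of_tuple e x"
        by (simp add: vec_of_tuple_def prod_algebra_def vec_eq_iff)
      then show ?thesis by (simp add: simps h_laws Q(2))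
    qed
    show "F s \<one>\<^bsub>prod_algebra d\<^esub> = \<one>\<^bsub>based_algebra d (\<mu>s s) u\<^esub>"
    proof -
      have "vec_of_tuple e \<one>\<^bsub>prod_algebra d\<^esub> = (\<chi> i. 1)"
        using e by (auto simp: vec_of_tuple_def prod_algebra_def vec_eq_iff d_def bij_betw_def)
      then show ?thesis by (simp add: simps h_laws)
    qed
    show "F s \<zero>\<^bsub>prod_algebra d\<^esub> = \<zero>\<^bsub>based_algebra d (\<mu>s s) u\<^esub>"
    proof -
      have "vec_of_tuple e \<zero>\<^bsub>prod_algebra d\<^esub> = 0"
        by (simp add: vec_of_tuple_def prod_algebra_def vec_eq_iff)
      then show ?thesis by (simp add: simps h_laws linear_0[OF Q(1)])
    qed
  qed (rule complex_algebra_prod_algebra)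
  moreover have "(\<lambda>s. \<mu>s s x y i) \<longlonglongrightarrow> \<mu> x y i" for x y i
  proof -
    have "(\<lambda>s. Q (mult3 (g s (vec_of_tuple e x)) (g s (vec_of_tuple e y)))) \<longlonglongrightarrow>
        Q (mult3 (\<phi> (vec_of_tuple e x)) (\<phi> (vec_of_tuple e y)))"
      by (intro bounded_linear.tendsto[OF linear_conv_bounded_linear[THEN iffD1, OF Q(1)]] tendsto_mult3 g)
    then show ?thesis
      unfolding \<mu>s_def \<mu>_def tuple_of_vec_def by (auto intro!: tendsto_intros)
  qed
  ultimately show ?thesis
    unfolding smoothable_def by (intro exI[of _ d] exI[of _ \<mu>] exI[of _ u] exI[of _ \<mu>s] exI[of _ "\<lambda>_. u"]) auto
qed

end
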